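(* Let $q$ be a prime power, let $C\subseteq\mathbb{F}_q^n$ be an $[n,k]$ code over $\mathbb{F}_q$, let $1\le d\le n$, and let $f\in\mathrm{Harm}_d(n)$. Then for any positive integer $m$ and every $0\le i\le n$, $$A_{i,f}^{q^m}(C)=\sum_{r=0}^{k}[m,r]_{q}\,A_{i,f}^{(r)}(C),$$ and $$Z_{C,f}(x,y;q^m)=\sum_{r=0}^{k}[m,r]_{q}\,Z_{C,f}^{(r)}(x,y).$$
   Context: Let $E=\{1,\dots,n\}$ and let $E_d$ be the set of $d$-element subsets of $E$. $\mathrm{Harm}_d(n)$ is the space of functions $f:E_d\to\mathbb{R}$ such that $\sum_{Z\in E_d,\,Y\subseteq Z}f(Z)=0$ for every $Y\in E_{d-1}$. For $X\subseteq E$ put $\widetilde f(X)=\sum_{Z\in E_d,\,Z\subseteq X}f(Z)$. An $[n,k]$ code over $\mathbb{F}_q$ is a $k$-dimensional linear subspace of $\mathbb{F}_q^n$. For a vector $\mathbf u$, $\mathrm{supp}(\mathbf u)=\{i\in E: u_i\ne 0\}$ and $\mathrm{wt}(\mathbf u)=|\mathrm{supp}(\mathbf u)|$; for a set $D$ of vectors, $\mathrm{Supp}(D)=\bigcup_{\mathbf u\in D}\mathrm{supp}(\mathbf u)$ and $\mathrm{wt}(D)=|\mathrm{Supp}(D)|$. Higher weights: $\mathcal{D}_r(C)$ is the set of $r$-dimensional linear subspaces of $C$; $A_{i,f}^{(r)}(C)=\sum_{D\in\mathcal{D}_r(C),\,\mathrm{wt}(D)=i}\widetilde f(\mathrm{Supp}(D))$;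 the harmonic $r$-th higher weight enumerator $W_{C,f}^{(r)}(x,y)=\sum_{i=0}^n A_{i,f}^{(r)}(C)x^{n-i}y^i$ equals $(xy)^dZ_{C,f}^{(r)}(x,y)$ with $Z_{C,f}^{(r)}(x,y)=\sum_{i=d}^{n-d}A_{i,f}^{(r)}(C)x^{n-i-d}y^{i-d}$. Extended weights: for a positive integer $m$, $C[q^m]=C\otimes\mathbb{F}_{q^m}\subseteq\mathbb{F}_{q^m}^n$ is the $\mathbb{F}_{q^m}$-linear span of $C$; $A_{i,f}^{q^m}(C)=\sum_{\mathbf u\in C[q^m],\,\mathrm{wt}(\mathbf u)=i}\widetilde f(\mathrm{supp}(\mathbf u))$; the harmonic $q^m$-extended weight enumerator $W_{C,f}(x,y;q^m)=\sum_{i=0}^nA_{i,f}^{q^m}(C)x^{n-i}y^i$ equals $(xy)^dZ_{C,f}(x,y;q^m)$ with $Z_{C,f}(x,y;q^m)=\sum_{i=d}^{n-d}A_{i,f}^{q^m}(C)x^{n-i-d}y^{i-d}$. Empty sums are $0$. For integers $a,b\ge0$, $[a,b]_q=\prod_{i=0}^{b-1}(q^a-q^i)$. *)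

theory Defs
  imports "HOL-Analysis.Cartesian_Space" "HOL-Computational_Algebra.Polynomial"
begin

text \<open>
  The coordinate set \<open>E\<close> is the finite index type \<open>'n\<close>, so \<open>n = CARD('n)\<close>. Linear algebra over
  an arbitrary field is that of the interpretation \<open>vec\<close> of \<open>vector_space\<close> by \<open>(*s)\<close>.
\<close>

text \<open>
  A function on the \<open>d\<close>-subsets is represented by a total function on \<open>'n set\<close>. Its values at sets
  of other cardinalities are arbitrary, and neither \<open>Harm\<close> nor \<open>tilde\<close> reads them. The intended
  range is \<open>d \<ge> 1\<close>, since \<open>d - 1\<close> is truncated.
\<close>

definition Harm :: "nat \<Rightarrow> ('n::finite set \<Rightarrow> real) set" where
  "Harm d = {f. \<forall>Y. card Y = d - 1 \<longrightarrow> (\<Sum>Z | card Z = d \<and> Y \<subseteq> Z. f Z) = 0}"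

definition tilde :: "nat \<Rightarrow> ('n::finite set \<Rightarrow> real) \<Rightarrow> 'n set \<Rightarrow> real" where
  "tilde d f X = (\<Sum>Z | card Z = d \<and> Z \<subseteq> X. f Z)"

definition is_code :: "nat \<Rightarrow> nat \<Rightarrow> ('a::field ^ 'n::finite) set \<Rightarrow> bool" where
  "is_code n k C \<longleftrightarrow> n = CARD('n) \<and> vec.subspace C \<and> vec.dim C = k"

definition supp :: "'a::zero ^ 'n::finite \<Rightarrow> 'n set" where
  "supp u = {i. u $ i \<noteq> 0}"

definition wt :: "'a::zero ^ 'n::finite \<Rightarrow> nat" where
  "wt u = card (supp u)"

definition Supp :: "('a::zero ^ 'n::finite) set \<Rightarrow> 'n set" where
  "Supp D = (\<Union>u\<in>D. supp u)"

definition Wt :: "('a::zero ^ 'n::finite) set \<Rightarrow> nat" where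
  "Wt D = card (Supp D)"

definition subcodes :: "nat \<Rightarrow> ('a::field ^ 'n::finite) set \<Rightarrow> ('a ^ 'n) set set" where
  "subcodes r C = {D. vec.subspace D \<and> D \<subseteq> C \<and> vec.dim D = r}"

definition A_higher ::
  "nat \<Rightarrow> ('n set \<Rightarrow> real) \<Rightarrow> nat \<Rightarrow> ('a::{field,finite} ^ 'n::finite) set \<Rightarrow> nat \<Rightarrow> real" where
  "A_higher d f r C i = (\<Sum>D | D \<in> subcodes r C \<and> Wt D = i. tilde d f (Supp D))"

text \<open>
  Since a field is simple as a ring, these conditions make \<open>h\<close> injective.
\<close>

definition field_embedding :: "('a::field \<Rightarrow> 'b::field) \<Rightarrow> bool" where
  "field_embedding h \<longleftrightarrow>
     h 1 = 1 \<and> (\<forall>x y. h (x + y) = h x + h y) \<and> (\<forall>x y. h (x * y) = h x * h y)"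

definition ext_code ::
  "('a::field \<Rightarrow> 'b::field) \<Rightarrow> ('a ^ 'n::finite) set \<Rightarrow> ('b ^ 'n) set" where
  "ext_code h C = vec.span ((\<lambda>u. \<chi> i. h (u $ i)) ` C)"

definition A_ext ::
  "nat \<Rightarrow> ('n set \<Rightarrow> real) \<Rightarrow> ('a::{field,finite} \<Rightarrow> 'b::{field,finite}) \<Rightarrow>
     ('a ^ 'n::finite) set \<Rightarrow> nat \<Rightarrow> real" where
  "A_ext d f h C i = (\<Sum>u | u \<in> ext_code h C \<and> wt u = i. tilde d f (supp u))"

text \<open>
  Polynomials in \<open>x\<close>, \<open>y\<close> are elements of \<open>real poly poly\<close>: \<open>x\<close> is the inner variable and \<open>y\<close> the
  outer one, so \<open>monom (monom c a) b\<close> is \<open>c x\<^sup>a y\<^sup>b\<close>. For \<open>d \<le> CARD('n)\<close> no subtraction below is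
  truncated on the range of summation, which is empty if \<open>CARD('n) < 2 * d\<close>.
\<close>

definition Z_higher ::
  "nat \<Rightarrow> ('n set \<Rightarrow> real) \<Rightarrow> nat \<Rightarrow> ('a::{field,finite} ^ 'n::finite) set \<Rightarrow> real poly poly" where
  "Z_higher d f r C =
     (\<Sum>i = d..CARD('n) - d. monom (monom (A_higher d f r C i) (CARD('n) - i - d)) (i - d))"

definition Z_ext ::
  "nat \<Rightarrow> ('n set \<Rightarrow> real) \<Rightarrow> ('a::{field,finite} \<Rightarrow> 'b::{field,finite}) \<Rightarrow>
     ('a ^ 'n::finite) set \<Rightarrow> real poly poly" where
  "Z_ext d f h C =
     (\<Sum>i = d..CARD('n) - d. monom (monom (A_ext d f h C i) (CARD('n) - i - d)) (i - d))"

definition qbracket :: "nat \<Rightarrow> nat \<Rightarrow> nat \<Rightarrow> int" where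
  "qbracket q a b = (\<Prod>i<b. int q ^ a - int q ^ i)"

end

theory Submission
  imports Defs
begin

text \<open>
  Write \<open>F\<close> for the base field and \<open>K\<close> for its extension of degree \<open>m\<close>. To a vector \<open>u\<close> over \<open>K\<close>
  attach the \<open>F\<close>-space \<open>D(u)\<close> of all vectors \<open>(l(u\<^sub>1), \<dots>, l(u\<^sub>n))\<close>, where \<open>l\<close> runs through the
  \<open>F\<close>-linear functionals on \<open>K\<close>. The identity holds because sorting the words of the extended code
  by \<open>D(u)\<close> turns the sum over words into a sum over subcodes, and every subcode of dimension \<open>r\<close>
  is hit by exactly \<open>[m,r]\<^sub>q\<close> words. Three properties of \<open>D(u)\<close> give this.

  Functionals separate points of \<open>K\<close>, so \<open>D(u)\<close> has the same support as \<open>u\<close>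
  (\<open>Supp_descent\<close>); hence \<open>u\<close> and \<open>D(u)\<close> have equal weight and equal value of \<open>tilde d f\<close>.

  Applying functionals to a \<open>K\<close>-combination of words of \<open>C\<close> gives \<open>F\<close>-combinations of them, and
  conversely \<open>u\<close> is recovered from \<open>D(u)\<close> by expanding its coordinates in an \<open>F\<close>-basis of \<open>K\<close>.
  So \<open>u\<close> lies in the extension of \<open>C\<close> exactly when \<open>D(u)\<close> is contained in \<open>C\<close>
  (\<open>descent_subset_iff\<close>).

  Finally, fix an \<open>F\<close>-basis \<open>G\<close> of a subcode \<open>D\<close>. The words of its extension are the combinations
  \<open>\<Sum>g. c\<^sub>g g\<close> with unique coefficients in \<open>K\<close>, and such a word has \<open>D(u)\<close> equal to all of \<open>D\<close>
  if and only if the coefficients \<open>c\<^sub>g\<close> are linearly independent over \<open>F\<close>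
  (\<open>descent_combination_eq_span_iff\<close>). The fibre over \<open>D\<close> therefore has as many elements as there
  are independent families of size \<open>dim D\<close> in a space with \<open>q\<^sup>m\<close> elements
  (\<open>card_descent_fibre\<close>). Choosing the members of such a family one at a time, each outside
  the span of the earlier ones, gives the product that defines \<open>[m, dim D]\<^sub>q\<close>.
\<close>

section \<open>Counting independent families over a finite field\<close>

lemma card_span_independent:
  fixes scale :: "'a::{field,finite} \<Rightarrow> 'b::ab_group_add \<Rightarrow> 'b"
  assumes "vector_space scale" "finite B" "\<not> module.dependent scale B"
  shows "card (module.span scale B) = CARD('a) ^ card B"
proof -
  interpret vector_space scale by fact
  let ?comb = "\<lambda>a. \<Sum>b\<in>B. scale (a b) b"
  have "?comb ` PiE B (\<lambda>_. UNIV) = span B"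
  proof -
    have "?comb a \<in> ?comb ` PiE B (\<lambda>_. UNIV)" for a
      by (rule image_eqI[where x = "restrict a B"]) auto
    then show ?thesis unfolding span_finite[OF assms(2)] by blast
  qed
  moreover have "inj_on ?comb (PiE B (\<lambda>_. UNIV))"
  proof (rule inj_onI)
    fix a a' assume a: "a \<in> PiE B (\<lambda>_. UNIV)" "a' \<in> PiE B (\<lambda>_. UNIV)" and eq: "?comb a = ?comb a'"
    have "(\<Sum>b\<in>B. scale (a b - a' b) b) = 0"
      using eq by (simp add: scale_left_diff_distrib sum_subtractf)
    then have "\<forall>b\<in>B. a b - a' b = 0"
      using independentD[OF assms(3,2) subset_refl, of "\<lambda>b. a b - a' b"] by blast
    then show "a = a'" using a by (intro PiE_ext) auto
  qed
  ultimately have "card (span B) = card (PiE B (\<lambda>_. UNIV :: 'a set))"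
    using card_image by fastforce
  then show ?thesis by (simp add: card_PiE assms(2))
qed

text \<open>
  A family indexed by \<open>insert x G\<close> is independent exactly when its restriction to \<open>G\<close> is and
  its member at \<open>x\<close> avoids the span of the others, which has \<open>q\<close> to the power \<open>card G\<close> elements.
  This gives one factor of the product for each index. When \<open>card G > m\<close> both sides are zero.
  Injectivity is part of the independence of a family, since the image set does not see repetitions.
\<close>

lemma card_independent_families:
  fixes scale :: "'a::{field,finite} \<Rightarrow> 'b::{ab_group_add,finite} \<Rightarrow> 'b"
  assumes "vector_space scale" "finite G" "CARD('b) = CARD('a) ^ m"
  shows "int (card {c \<in> PiE G (\<lambda>_. UNIV). inj_on c G \<and> \<not> module.dependent scale (c ` G)})
         = qbracket (CARD('a)) m (card G)"
  using assms(2)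
proof (induction G rule: finite_induct)
  interpret vector_space scale by fact
  case empty
  have "{c. c = (\<lambda>x. undefined) \<and> independent {}} = {\<lambda>x::'c. undefined :: 'b}"
    using independent_empty by simp
  then show ?case by (simp add: qbracket_def)
next
  case (insert x G)
  interpret vector_space scale by fact
  let ?S = "\<lambda>G :: 'c set. {c \<in> PiE G (\<lambda>_. UNIV). inj_on c G \<and> independent (c ` G)}"
  let ?T = "SIGMA c : ?S G. - span (c ` G)"
  let ?up = "\<lambda>(c :: 'c \<Rightarrow> 'b, y :: 'b). c(x := y)"
  have "bij_betw ?up ?T (?S (insert x G))"
  proof (rule bij_betw_byWitness[where f' = "\<lambda>c. (c(x := undefined), c x)"])
    show "\<forall>p\<in>?T. (\<lambda>c. (c(x := undefined), c x)) (?up p) = p"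
    proof
      fix p assume "p \<in> ?T"
      then obtain c y where p: "p = (c, y)" "c \<in> PiE G (\<lambda>_. UNIV)" by blast
      have "c x = undefined" using p(2) insert.hyps(2) by (rule PiE_arb)
      then show "(\<lambda>c. (c(x := undefined), c x)) (?up p) = p" by (simp add: p(1) fun_upd_idem)
    qed
    show "\<forall>c\<in>?S (insert x G). ?up (c(x := undefined), c x) = c" by auto
    show "?up ` ?T \<subseteq> ?S (insert x G)"
    proof (rule image_subsetI)
      fix p assume "p \<in> ?T"
      then obtain c y where p: "p = (c, y)" and y: "y \<notin> span (c ` G)"
        and c: "c \<in> PiE G (\<lambda>_. UNIV)" "inj_on c G" "independent (c ` G)" by blast
      have im: "c(x := y) ` G = c ` G" using insert.hyps(2) by (auto simp: image_def)
      have yi: "y \<notin> c ` G" using y span_base by blast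
      have "inj_on (c(x := y)) (insert x G)"
        using c(2) yi insert.hyps(2) by (auto simp: inj_on_def)
      moreover have "independent (insert y (c ` G))"
        using independent_insert[of y "c ` G"] yi y c(3) by simp
      moreover have "c(x := y) \<in> PiE (insert x G) (\<lambda>_. UNIV)"
        using c(1) by (auto simp: PiE_def extensional_def)
      ultimately show "?up p \<in> ?S (insert x G)"
        using im p by simp
    qed
    show "(\<lambda>c. (c(x := undefined), c x)) ` ?S (insert x G) \<subseteq> ?T"
    proof (rule image_subsetI)
      fix c assume "c \<in> ?S (insert x G)"
      then have c: "c \<in> PiE (insert x G) (\<lambda>_. UNIV)" "inj_on c G"
        "c x \<notin> c ` (G - {x})" "independent (insert (c x) (c ` G))" by simp_all
      have im: "c(x := undefined) ` G = c ` G" using insert.hyps(2) by (auto simp: image_def)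
      have "c x \<notin> c ` G" using c(3) insert.hyps(2) by simp
      then have "independent (c ` G)" "c x \<notin> span (c ` G)"
        using c(4) independent_insert[of "c x" "c ` G"] by auto
      moreover have "inj_on (c(x := undefined)) G"
        using c(2) insert.hyps(2) by (auto simp: inj_on_def)
      moreover have "c(x := undefined) \<in> PiE G (\<lambda>_. UNIV)"
        using c(1) insert.hyps(2) by (auto simp: PiE_def extensional_def)
      ultimately show "(c(x := undefined), c x) \<in> ?T"
        using im by simp
    qed
  qed
  then have "card (?S (insert x G)) = card ?T"
    by (rule bij_betw_same_card[symmetric])
  also have "\<dots> = (\<Sum>c\<in>?S G. card (- span (c ` G)))"
    by (rule card_SigmaI) (auto intro!: finite_subset[OF _ finite_PiE[OF insert.hyps(1)]])
  finally have "int (card (?S (insert x G))) = (\<Sum>c\<in>?S G. int (card (- span (c ` G))))"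
    by simp
  also have "\<dots> = (\<Sum>c\<in>?S G. int (CARD('a)) ^ m - int (CARD('a)) ^ card G)"
  proof (rule sum.cong[OF refl])
    fix c assume c: "c \<in> ?S G"
    then have "card (c ` G) = card G" by (auto intro: card_image)
    then have "card (span (c ` G)) = CARD('a) ^ card G"
      using card_span_independent[OF assms(1), of "c ` G"] c insert.hyps(1) by simp
    moreover have "int (card (- span (c ` G))) = int CARD('b) - int (card (span (c ` G)))"
      by (simp add: Compl_eq_Diff_UNIV card_Diff_subset of_nat_diff card_mono)
    ultimately show "int (card (- span (c ` G))) = int (CARD('a)) ^ m - int (CARD('a)) ^ card G"
      by (simp add: assms(3))
  qed
  also have "\<dots> = qbracket (CARD('a)) m (card G) * (int (CARD('a)) ^ m - int (CARD('a)) ^ card G)"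
    using insert.IH by simp
  also have "\<dots> = qbracket (CARD('a)) m (card (insert x G))"
    using insert.hyps by (simp add: qbracket_def)
  finally show ?case .
qed

section \<open>Functionals of a finite field extension\<close>

text \<open>
  The larger field is regarded as a vector space over the smaller one through \<open>h\<close>: the prefix \<open>K\<close>
  refers to this structure, and \<open>KF\<close> to linear maps from it to the smaller field.
\<close>

locale finite_field_extension =
  fixes h :: "'a::{field,finite} \<Rightarrow> 'b::{field,finite}"
  assumes embedding: "field_embedding h"
begin

lemma h_one: "h 1 = 1" and h_add: "h (x + y) = h x + h y" and h_mult: "h (x * y) = h x * h y"
  using embedding by (auto simp: field_embedding_def)

lemma h_zero: "h 0 = 0"
  using h_add[of 0 0] unfolding add_0_left by (simp only: add_cancel_right_right)

sublocale K: vector_space "\<lambda>a x. h a * x"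
  by standard (simp_all add: h_one h_add h_mult algebra_simps)

sublocale FF: vector_space "(*) :: 'a \<Rightarrow> 'a \<Rightarrow> 'a"
  by standard (simp_all add: algebra_simps)

sublocale KF: vector_space_pair "\<lambda>a x. h a * x" "(*) :: 'a \<Rightarrow> 'a \<Rightarrow> 'a"
  by standard

definition functional :: "('b \<Rightarrow> 'a) \<Rightarrow> bool" where
  "functional l \<longleftrightarrow> Vector_Spaces.linear (\<lambda>a x. h a * x) (*) l"

lemma functional_scale: "functional l \<Longrightarrow> l (h a * x) = a * l x"
  and functional_zero: "functional l \<Longrightarrow> l 0 = 0"
  and functional_sum: "functional l \<Longrightarrow> l (sum g S) = (\<Sum>x\<in>S. l (g x))"
  unfolding functional_def
  by (simp_all add: KF.linear_scale KF.linear_0 KF.linear_sum)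

lemma functional_extend:
  assumes "K.independent B"
  obtains l where "functional l" "\<And>b. b \<in> B \<Longrightarrow> l b = g b"
  using KF.linear_independent_extend[OF assms, of g] unfolding functional_def by blast

lemma functional_separates:
  assumes "x \<noteq> 0"
  obtains l where "functional l" "l x = 1"
proof -
  have "K.independent {x}" using assms by simp
  then obtain l where l: "functional l" "\<And>b. b \<in> {x} \<Longrightarrow> l b = 1"
    using functional_extend[of "{x}" "\<lambda>_. 1"] by blast
  show ?thesis by (rule that[OF l(1)]) (simp add: l(2))
qed

section \<open>The subcode attached to a word of the extended code\<close>

definition lift_vec :: "'a ^ 'n \<Rightarrow> 'b ^ 'n::finite" where
  "lift_vec v = (\<chi> i. h (v $ i))"

definition apply_vec :: "('b \<Rightarrow> 'a) \<Rightarrow> 'b ^ 'n \<Rightarrow> 'a ^ 'n::finite" where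
  "apply_vec l u = (\<chi> i. l (u $ i))"

text \<open>
  This is the space \<open>D(u)\<close> of the introduction, the smallest subspace over the small field whose
  extension contains \<open>u\<close>. Using all functionals makes it independent of a choice of basis.
\<close>

definition descent :: "'b ^ 'n \<Rightarrow> ('a ^ 'n::finite) set" where
  "descent u = {apply_vec l u | l. functional l}"

lemma ext_code_lift: "ext_code h C = vec.span (lift_vec ` C)"
  by (simp add: ext_code_def lift_vec_def)

lemma apply_vec_combination:
  assumes "functional l"
  shows "apply_vec l (\<Sum>j\<in>J. c j *s lift_vec (v j)) = (\<Sum>j\<in>J. l (c j) *s v j)"
proof (rule vec_eq_iff[THEN iffD2], rule allI)
  fix i
  have "l (\<Sum>j\<in>J. c j * h (v j $ i)) = (\<Sum>j\<in>J. l (c j) * v j $ i)"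
    unfolding functional_sum[OF assms]
    by (rule sum.cong) (metis functional_scale[OF assms] mult.commute)+
  then show "apply_vec l (\<Sum>j\<in>J. c j *s lift_vec (v j)) $ i = (\<Sum>j\<in>J. l (c j) *s v j) $ i"
    by (simp add: apply_vec_def lift_vec_def)
qed

lemma ext_code_span:
  assumes "finite G"
  shows "ext_code h (vec.span G) = range (\<lambda>c. \<Sum>g\<in>G. c g *s lift_vec g)"
proof -
  have lin: "lift_vec (\<Sum>g\<in>G. a g *s g) = (\<Sum>g\<in>G. h (a g) *s lift_vec g)" for a and G :: "('a ^ 'n) set"
  proof -
    have hs: "h (\<Sum>g\<in>G. k g) = (\<Sum>g\<in>G. h (k g))" for k :: "'a ^ 'n \<Rightarrow> 'a"
      by (induction G rule: infinite_finite_induct) (simp_all add: h_zero h_add)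
    show ?thesis by (simp add: lift_vec_def vec_eq_iff hs h_mult)
  qed
  let ?R = "range (\<lambda>c. \<Sum>g\<in>G. c g *s lift_vec g)"
  have "vec.subspace ?R"
  proof (rule vec.subspaceI)
    show "0 \<in> ?R" by (rule image_eqI[where x = "\<lambda>_. 0"]) simp_all
  next
    fix x y assume "x \<in> ?R" "y \<in> ?R"
    then obtain c c' where "x = (\<Sum>g\<in>G. c g *s lift_vec g)" "y = (\<Sum>g\<in>G. c' g *s lift_vec g)"
      by blast
    then show "x + y \<in> ?R"
      by (intro image_eqI[where x = "\<lambda>g. c g + c' g"]) (simp_all add: sum.distrib vec.scale_left_distrib)
  next
    fix a x assume "x \<in> ?R"
    then obtain c where "x = (\<Sum>g\<in>G. c g *s lift_vec g)" by blast
    then show "a *s x \<in> ?R"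
      by (intro image_eqI[where x = "\<lambda>g. a * c g"]) (simp_all add: vec.scale_sum_right)
  qed
  moreover have "lift_vec ` vec.span G \<subseteq> ?R"
    unfolding vec.span_finite[OF assms]
  proof clarify
    fix a
    show "lift_vec (\<Sum>g\<in>G. a g *s g) \<in> ?R"
      by (rule image_eqI[where x = "\<lambda>g. h (a g)"]) (simp_all add: lin)
  qed
  ultimately have "ext_code h (vec.span G) \<subseteq> ?R"
    unfolding ext_code_lift by (rule vec.span_minimal[rotated])
  moreover have "?R \<subseteq> ext_code h (vec.span G)"
    unfolding ext_code_lift
  proof clarify
    fix c
    show "(\<Sum>g\<in>G. c g *s lift_vec g) \<in> vec.span (lift_vec ` vec.span G)"
      by (intro vec.span_sum vec.span_scale vec.span_base imageI)
  qed
  ultimately show ?thesis by blast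
qed

lemma subspace_descent: "vec.subspace (descent u)"
proof (rule vec.subspaceI)
  have "functional (\<lambda>_. 0)" unfolding functional_def by (rule KF.linear_zero)
  moreover have "0 = apply_vec (\<lambda>_. 0) u" by (simp add: apply_vec_def vec_eq_iff)
  ultimately show "0 \<in> descent u" unfolding descent_def by blast
next
  fix x y assume "x \<in> descent u" "y \<in> descent u"
  then obtain l l' where l: "functional l" "functional l'" "x = apply_vec l u" "y = apply_vec l' u"
    unfolding descent_def by blast
  have "functional (\<lambda>z. l z + l' z)" using l(1,2) unfolding functional_def by (rule KF.linear_compose_add)
  moreover have "x + y = apply_vec (\<lambda>z. l z + l' z) u"
    by (simp add: l apply_vec_def vec_eq_iff)
  ultimately show "x + y \<in> descent u" unfolding descent_def by blast
next
  fix a x assume "x \<in> descent u"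
  then obtain l where l: "functional l" "x = apply_vec l u" unfolding descent_def by blast
  have "functional (\<lambda>z. a * l z)" using l(1) unfolding functional_def by (rule KF.linear_compose_scale_right)
  moreover have "a *s x = apply_vec (\<lambda>z. a * l z) u"
    by (simp add: l apply_vec_def vec_eq_iff)
  ultimately show "a *s x \<in> descent u" unfolding descent_def by blast
qed

lemma Supp_descent: "Supp (descent u) = supp u"
proof
  show "Supp (descent u) \<subseteq> supp u"
    by (auto simp: Supp_def supp_def descent_def apply_vec_def) (metis functional_zero)
  show "supp u \<subseteq> Supp (descent u)"
  proof
    fix i assume "i \<in> supp u"
    then have "u $ i \<noteq> 0" by (simp add: supp_def)
    then obtain l where l: "functional l" "l (u $ i) = 1" by (rule functional_separates)
    have "apply_vec l u \<in> descent u" using l(1) by (auto simp: descent_def)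
    moreover have "i \<in> supp (apply_vec l u)" using l(2) by (simp add: supp_def apply_vec_def)
    ultimately show "i \<in> Supp (descent u)" by (auto simp: Supp_def)
  qed
qed

text \<open>
  Over a basis \<open>B\<close> of the large field, \<open>u\<close> is the combination of its vectors of \<open>b\<close>-coordinates
  with coefficients \<open>b\<close>, and the coordinate maps are functionals.
\<close>

lemma mem_ext_code_descent: "u \<in> ext_code h (descent u)"
proof -
  obtain B where B: "K.independent B" "K.span B = UNIV"
    using K.basis_exists[of UNIV] by (metis top.extremum_uniqueI)
  have fB: "finite B" by simp
  have "\<exists>l. functional l \<and> (\<forall>b'\<in>B. l b' = (if b' = b then 1 else 0))" for b
    using functional_extend[OF B(1), of "\<lambda>b'. if b' = b then 1 else 0"] by metis
  then obtain coord where coord: "\<And>b. functional (coord b)"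
      "\<And>b b'. b' \<in> B \<Longrightarrow> coord b b' = (if b' = b then 1 else 0)"
    by metis
  have expand: "x = (\<Sum>b\<in>B. h (coord b x) * b)" for x
  proof -
    have "x \<in> K.span B" using B(2) by simp
    then obtain a where a: "x = (\<Sum>b\<in>B. h (a b) * b)"
      unfolding K.span_finite[OF fB] by blast
    have "coord b x = a b" if "b \<in> B" for b
    proof -
      have "coord b x = (\<Sum>b'\<in>B. a b' * (if b' = b then 1 else 0))"
        unfolding a functional_sum[OF coord(1)]
        by (rule sum.cong) (simp_all add: functional_scale[OF coord(1)] coord(2))
      also have "\<dots> = a b" using that fB by (simp add: if_distrib cong: if_cong)
      finally show ?thesis .
    qed
    then show ?thesis using a by (metis (no_types, lifting) sum.cong)
  qed
  have "u = (\<Sum>b\<in>B. b *s lift_vec (apply_vec (coord b) u))"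
    unfolding vec_eq_iff
    by (auto simp: lift_vec_def apply_vec_def mult.commute intro: trans[OF expand])
  moreover have "(\<Sum>b\<in>B. b *s lift_vec (apply_vec (coord b) u)) \<in> ext_code h (descent u)"
    unfolding ext_code_lift
  proof (intro vec.span_sum vec.span_scale vec.span_base imageI)
    show "apply_vec (coord b) u \<in> descent u" for b
      using coord(1) unfolding descent_def by blast
  qed
  ultimately show ?thesis by simp
qed

lemma descent_subset_iff:
  assumes "vec.subspace C"
  shows "descent u \<subseteq> C \<longleftrightarrow> u \<in> ext_code h C"
proof
  assume "descent u \<subseteq> C"
  then have "ext_code h (descent u) \<subseteq> ext_code h C"
    unfolding ext_code_lift by (intro vec.span_mono image_mono)
  then show "u \<in> ext_code h C" using mem_ext_code_descent by blast
next
  assume u: "u \<in> ext_code h C"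
  have "vec.span C = C" using assms by (simp add: vec.span_eq_iff)
  then have "u \<in> range (\<lambda>c. \<Sum>g\<in>C. c g *s lift_vec g)"
    using u ext_code_span[OF finite, of C] by metis
  then obtain c where c: "u = (\<Sum>g\<in>C. c g *s lift_vec g)"
    by blast
  show "descent u \<subseteq> C"
  proof
    fix v assume "v \<in> descent u"
    then obtain l where l: "functional l" "v = apply_vec l u" unfolding descent_def by blast
    have "v = (\<Sum>g\<in>C. l (c g) *s g)" unfolding l(2) c by (rule apply_vec_combination[OF l(1)])
    then show "v \<in> C" using assms by (auto intro!: vec.subspace_sum vec.subspace_scale)
  qed
qed

text \<open>
  The attached space consists of the combinations of \<open>G\<close> with coefficients \<open>l (c g)\<close>. If the \<open>c g\<close>
  are independent, functionals take arbitrary values on them, so every element of the span occurs.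
  Conversely, if each single \<open>g\<close> occurs, the independence of \<open>G\<close> provides functionals dual to the
  family \<open>c\<close>, and a family that has a dual one is independent.
\<close>

lemma descent_combination_eq_span_iff:
  assumes "vec.independent G"
  shows "descent (\<Sum>g\<in>G. c g *s lift_vec g) = vec.span G
     \<longleftrightarrow> inj_on c G \<and> K.independent (c ` G)" (is "?L \<longleftrightarrow> ?R")
proof
  let ?u = "\<Sum>g\<in>G. c g *s lift_vec g"
  have fG: "finite G" by simp
  have desc: "descent ?u = {\<Sum>g\<in>G. l (c g) *s g | l. functional l}"
    unfolding descent_def by (intro Collect_cong ex_cong1 rev_conj_cong refl) (simp add: apply_vec_combination)
  {
    assume ?R
    have "vec.span G \<subseteq> descent ?u"
    proof
      fix v assume "v \<in> vec.span G"
      then obtain a where a: "v = (\<Sum>g\<in>G. a g *s g)" unfolding vec.span_finite[OF fG] by blast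
      obtain l where l: "functional l" "\<And>x. x \<in> c ` G \<Longrightarrow> l x = a (the_inv_into G c x)"
        using functional_extend[of "c ` G" "\<lambda>x. a (the_inv_into G c x)"] \<open>?R\<close> by blast
      have "l (c g) = a g" if "g \<in> G" for g
        using that l(2)[of "c g"] \<open>?R\<close> by (simp add: the_inv_into_f_f)
      then have "v = (\<Sum>g\<in>G. l (c g) *s g)" unfolding a by (auto intro: sum.cong)
      then show "v \<in> descent ?u" unfolding desc using l(1) by blast
    qed
    moreover have "descent ?u \<subseteq> vec.span G"
      unfolding desc by clarify (intro vec.span_sum vec.span_scale vec.span_base)
    ultimately show ?L by blast
  }
  {
    assume ?L
    have dual: "\<exists>l. functional l \<and> l (c g) = 1 \<and> (\<forall>g'\<in>G - {g}. l (c g') = 0)" if g: "g \<in> G" for g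
    proof -
      have "g \<in> descent ?u" using \<open>?L\<close> g vec.span_base by blast
      then obtain l where l: "functional l" "g = (\<Sum>g'\<in>G. l (c g') *s g')" unfolding desc by blast
      have one: "g = (\<Sum>g'\<in>G. (if g' = g then 1 else 0) *s g')"
      proof -
        have "(\<Sum>g'\<in>G. (if g' = g then 1 else 0) *s g') = (\<Sum>g'\<in>G. if g' = g then g' else 0)"
          by (rule sum.cong) simp_all
        then show ?thesis using g fG by simp
      qed
      have "(\<Sum>g'\<in>G. (l (c g') - (if g' = g then 1 else 0)) *s g') = 0"
        unfolding vec.scale_left_diff_distrib sum_subtractf l(2)[symmetric] one[symmetric] by simp
      then have eq0: "l (c g') - (if g' = g then 1 else 0) = 0" if "g' \<in> G" for g'
        using vec.independentD[OF assms fG subset_refl, of "\<lambda>g'. l (c g') - (if g' = g then 1 else 0)"]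
          that by blast
      have "l (c g) = 1" using eq0[OF g] by simp
      moreover have "l (c g') = 0" if "g' \<in> G - {g}" for g' using eq0[of g'] that by simp
      ultimately show ?thesis using l(1) by blast
    qed
    have inj: "inj_on c G"
    proof (rule inj_onI, rule ccontr)
      fix g g' assume *: "g \<in> G" "g' \<in> G" "c g = c g'" "g \<noteq> g'"
      then obtain l where "functional l" "l (c g) = 1" "\<forall>g'\<in>G - {g}. l (c g') = 0" using dual[OF *(1)] by blast
      then show False using * by auto
    qed
    have "K.independent (c ` G)"
      unfolding K.dependent_def
    proof
      assume "\<exists>x\<in>c ` G. x \<in> K.span (c ` G - {x})"
      then obtain g where g: "g \<in> G" "c g \<in> K.span (c ` G - {c g})" by blast
      obtain l where l: "functional l" "l (c g) = 1" "\<forall>g'\<in>G - {g}. l (c g') = 0"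
        using dual[OF g(1)] by blast
      have "l x = 0" if "x \<in> c ` G - {c g}" for x using that l(3) by auto
      then have "l (c g) = 0"
        using KF.linear_eq_0_on_span[OF l(1)[unfolded functional_def] _ g(2)] by blast
      then show False using l(2) by simp
    qed
    with inj show ?R by blast
  }
qed

text \<open>
  Independence over the small field survives extension: a functional that detects a difference
  of two coefficients would turn equal combinations into a nontrivial relation in \<open>G\<close>.
\<close>

lemma lift_vec_coefficients_unique:
  assumes "vec.independent G" "(\<Sum>g\<in>G. c g *s lift_vec g) = (\<Sum>g\<in>G. c' g *s lift_vec g)" "g \<in> G"
  shows "c g = c' g"
proof (rule ccontr)
  assume "c g \<noteq> c' g"
  then obtain l where l: "functional l" "l (c g - c' g) = 1"
    using functional_separates[of "c g - c' g"] by auto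
  have "(\<Sum>g\<in>G. l (c g - c' g) *s g) = apply_vec l (\<Sum>g\<in>G. (c g - c' g) *s lift_vec g)"
    by (rule apply_vec_combination[OF l(1), symmetric])
  also have "\<dots> = apply_vec l 0"
    by (simp add: vec.scale_left_diff_distrib sum_subtractf assms(2))
  also have "\<dots> = 0" by (simp add: apply_vec_def vec_eq_iff functional_zero[OF l(1)])
  finally have "l (c g - c' g) = 0"
    using vec.independentD[OF assms(1) _ subset_refl, of "\<lambda>g. l (c g - c' g)"] assms(3) by simp
  then show False using l(2) by simp
qed

section \<open>Sorting words by their attached subcodes\<close>

lemma card_descent_fibre:
  fixes D :: "('a ^ 'n::finite) set"
  assumes D: "vec.subspace D" and m: "CARD('b) = CARD('a) ^ m"
  shows "int (card {u. descent u = D}) = qbracket (CARD('a)) m (vec.dim D)"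
proof -
  obtain G where G: "G \<subseteq> D" "vec.independent G" "D \<subseteq> vec.span G" "card G = vec.dim D"
    using vec.basis_exists[of D] by blast
  have sp: "vec.span G = D" using G(1,3) D vec.span_minimal by blast
  have fG: "finite G" by simp
  let ?comb = "\<lambda>c. \<Sum>g\<in>G. c g *s lift_vec g"
  let ?S = "{c \<in> PiE G (\<lambda>_. UNIV). inj_on c G \<and> K.independent (c ` G)}"
  have image: "?comb ` ?S = {u. descent u = D}"
  proof
    show "?comb ` ?S \<subseteq> {u. descent u = D}"
      using descent_combination_eq_span_iff[OF G(2)] sp by auto
    show "{u. descent u = D} \<subseteq> ?comb ` ?S"
    proof
      fix u assume "u \<in> {u. descent u = D}"
      then have u: "descent u = D" by simp
      then have "u \<in> ext_code h (vec.span G)" using mem_ext_code_descent[of u] sp by simp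
      then obtain c0 where c0: "u = ?comb c0" unfolding ext_code_span[OF fG] by blast
      \<comment> \<open>families are counted as extensional functions on \<open>G\<close>\<close>
      define c where "c = restrict c0 G"
      have uc: "u = ?comb c" unfolding c0 c_def by (rule sum.cong) simp_all
      then have "inj_on c G \<and> K.independent (c ` G)"
        using u sp descent_combination_eq_span_iff[OF G(2), of c] by simp
      moreover have "c \<in> PiE G (\<lambda>_. UNIV)" by (simp add: c_def)
      ultimately show "u \<in> ?comb ` ?S" using uc by blast
    qed
  qed
  have "inj_on ?comb ?S"
  proof (rule inj_onI)
    fix c c' assume "c \<in> ?S" "c' \<in> ?S" "?comb c = ?comb c'"
    then show "c = c'" using lift_vec_coefficients_unique[OF G(2)] by (intro PiE_ext[of c G _ c']) auto
  qed
  from card_image[OF this] have "card {u. descent u = D} = card ?S"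
    unfolding image .
  then show ?thesis
    using card_independent_families[OF K.vector_space_axioms fG m] G(4) by simp
qed

text \<open>
  The sum over words is grouped first by attached subcode, where the summand is constant on each
  fibre, and then by the dimension of the subcode.
\<close>

lemma A_ext_eq_sum_A_higher:
  fixes C :: "('a ^ 'n::finite) set"
  assumes C: "vec.subspace C" and m: "CARD('b) = CARD('a) ^ m"
  shows "A_ext d f h C i
    = (\<Sum>r=0..vec.dim C. real_of_int (qbracket (CARD('a)) m r) * A_higher d f r C i)"
proof -
  let ?U = "{u. u \<in> ext_code h C \<and> wt u = i}"
  let ?S = "{D. vec.subspace D \<and> D \<subseteq> C \<and> Wt D = i}"
  let ?w = "\<lambda>D. real_of_int (qbracket (CARD('a)) m (vec.dim D)) * tilde d f (Supp D)"
  have fin: "finite ?S" by simp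
  have maps: "descent ` ?U \<subseteq> ?S"
    using descent_subset_iff[OF C] by (auto simp only: subspace_descent Wt_def wt_def Supp_descent)
  have fibre: "{u \<in> ?U. descent u = D} = {u. descent u = D}" if "D \<in> ?S" for D
    using that by (auto simp: descent_subset_iff[OF C, symmetric] Wt_def wt_def Supp_descent)
  have "A_ext d f h C i = (\<Sum>D\<in>?S. \<Sum>u | u \<in> ?U \<and> descent u = D. tilde d f (supp u))"
    unfolding A_ext_def by (rule sum.group[symmetric, OF _ fin maps]) simp
  also have "\<dots> = (\<Sum>D\<in>?S. ?w D)"
  proof (rule sum.cong[OF refl])
    fix D assume D: "D \<in> ?S"
    have "(\<Sum>u | u \<in> ?U \<and> descent u = D. tilde d f (supp u))
        = (\<Sum>u | descent u = D. tilde d f (Supp D))"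
      by (rule sum.cong) (use fibre[OF D] in \<open>auto simp: Supp_descent\<close>)
    also have "\<dots> = real_of_int (int (card {u. descent u = D})) * tilde d f (Supp D)" by simp
    also have "\<dots> = ?w D" using D by (simp only: card_descent_fibre[OF _ m] mem_Collect_eq)
    finally show "(\<Sum>u | u \<in> ?U \<and> descent u = D. tilde d f (supp u)) = ?w D" .
  qed
  also have "\<dots> = (\<Sum>r=0..vec.dim C. \<Sum>D | D \<in> ?S \<and> vec.dim D = r. ?w D)"
    by (rule sum.group[symmetric, OF fin]) (auto intro: vec.dim_subset)
  also have "\<dots> = (\<Sum>r=0..vec.dim C. real_of_int (qbracket (CARD('a)) m r) * A_higher d f r C i)"
  proof (rule sum.cong[OF refl])
    fix r
    have "(\<Sum>D | D \<in> ?S \<and> vec.dim D = r. ?w D)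
        = (\<Sum>D | D \<in> subcodes r C \<and> Wt D = i.
             real_of_int (qbracket (CARD('a)) m r) * tilde d f (Supp D))"
      by (rule sum.cong) (auto simp: subcodes_def)
    then show "(\<Sum>D | D \<in> ?S \<and> vec.dim D = r. ?w D)
        = real_of_int (qbracket (CARD('a)) m r) * A_higher d f r C i"
      by (simp add: A_higher_def sum_distrib_left)
  qed
  finally show ?thesis .
qed

end

lemma of_int_mult_monom_monom:
  "of_int z * monom (monom (a :: 'a::comm_ring_1) s) t = monom (monom (of_int z * a) s) t"
  by (simp add: of_int_poly smult_monom)

theorem theorem3p5:
  fixes C :: "('a::{field,finite} ^ 'n::finite) set"
    and f :: "'n set \<Rightarrow> real"
    and h :: "'a \<Rightarrow> 'b::{field,finite}"
    and q n k d m :: nat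
  assumes "CARD('a) = q"
    and "is_code n k C"
    and "1 \<le> d" and "d \<le> n"
    and "f \<in> Harm d"
    and "m > 0"
    and "CARD('b) = q ^ m"
    and "field_embedding h"
  shows "(\<forall>i\<le>n. A_ext d f h C i
            = (\<Sum>r=0..k. real_of_int (qbracket q m r) * A_higher d f r C i))
       \<and> Z_ext d f h C = (\<Sum>r=0..k. of_int (qbracket q m r) * Z_higher d f r C)"
proof -
  interpret finite_field_extension h by standard fact
  have C: "vec.subspace C" "vec.dim C = k" using assms(2) by (simp_all add: is_code_def)
  have A: "A_ext d f h C i = (\<Sum>r=0..k. real_of_int (qbracket q m r) * A_higher d f r C i)" for i
    using A_ext_eq_sum_A_higher[OF C(1), of m d f i] assms(1,7) C(2) by simp
  have "Z_ext d f h C = (\<Sum>i = d..CARD('n) - d. \<Sum>r=0..k. of_int (qbracket q m r) *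
      monom (monom (A_higher d f r C i) (CARD('n) - i - d)) (i - d))"
    unfolding Z_ext_def A of_int_mult_monom_monom by (simp only: monom_sum)
  also have "\<dots> = (\<Sum>r=0..k. of_int (qbracket q m r) * Z_higher d f r C)"
    unfolding Z_higher_def sum_distrib_left by (rule sum.swap)
  finally show ?thesis using A by blast
qed

end
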